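(* Let $\mathbb{H}_1^a$ be the unit ball of the RKHS of the process $W^a=(W_t^a:0\le t\le1)$. Then $$\log N(\epsilon,\mathbb{H}_1^a,\|\cdot\|_\infty)\lesssim\max(a,1)\cdot\{\log(1/\epsilon)\}^2 .$$
   Context: For $a>0$, $W^a$ is the centered Gaussian process on $[0,1]$ with squared exponential periodic covariance kernel $G_a(t,t')=\exp\{-4a^2\sin^2(\pi t-\pi t')\}$. RKHS means reproducing kernel Hilbert space. $\|\cdot\|_\infty$ is the supremum norm on $[0,1]$, and $N(\epsilon,A,\|\cdot\|_\infty)$ is the $\epsilon$-covering number of $A$, i.e. the minimal number of balls of radius $\epsilon$ in this norm needed to cover $A$. The notation $f\lesssim g$ means that there is a universal constant $C$ such that $f\le Cg$.
   Formalization: The bound is stated for 0 < ε < 1/2; without a range it fails as ε approaches 1, where N ≥ 2 but log(1/ε) tends to 0. The universal constant is stated per sample space, which is harmless since the RKHS depends only on G_a. *)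

theory Defs
  imports "HOL-Probability.Probability" "HOL-Library.Extended_Nat" "HOL-Library.FuncSet"
begin

section \<open>Centered Gaussian processes\<close>

text \<open>The degenerate law at 0 counts as Gaussian. It does occur for the kernel below:
  \<open>4 a\<^sup>2 sin\<^sup>2 (\<pi> 0 - \<pi> 1) = 0\<close>, so \<open>W 0 - W 1\<close> vanishes almost surely.\<close>

definition centered_gaussian :: "'w measure \<Rightarrow> ('w \<Rightarrow> real) \<Rightarrow> bool" where
  "centered_gaussian M X \<longleftrightarrow>
     X \<in> borel_measurable M \<and>
     ((AE \<omega> in M. X \<omega> = 0) \<or> (\<exists>\<sigma>>0. distributed M lborel X (normal_density 0 \<sigma>)))"

definition centered_gaussian_process ::
    "'w measure \<Rightarrow> 'i set \<Rightarrow> ('i \<Rightarrow> 'w \<Rightarrow> real) \<Rightarrow> bool" where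
  "centered_gaussian_process M T W \<longleftrightarrow>
     prob_space M \<and>
     (\<forall>F \<alpha>. finite F \<and> F \<subseteq> T \<longrightarrow> centered_gaussian M (\<lambda>\<omega>. \<Sum>t\<in>F. \<alpha> t * W t \<omega>))"

definition cov_kernel :: "'w measure \<Rightarrow> ('i \<Rightarrow> 'w \<Rightarrow> real) \<Rightarrow> 'i \<Rightarrow> 'i \<Rightarrow> real" where
  "cov_kernel M W s t =
     (\<integral>\<omega>. (W s \<omega> - (\<integral>\<omega>'. W s \<omega>' \<partial>M)) * (W t \<omega> - (\<integral>\<omega>'. W t \<omega>' \<partial>M)) \<partial>M)"

definition sqexp_periodic_kernel :: "real \<Rightarrow> real \<Rightarrow> real \<Rightarrow> real" where
  "sqexp_periodic_kernel a t t' = exp (- 4 * a\<^sup>2 * (sin (pi * t - pi * t'))\<^sup>2)"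


section \<open>Reproducing kernel Hilbert spaces\<close>

text \<open>A finitely supported coefficient function \<open>c\<close> stands for the kernel combination
  \<open>\<Sum>s. c s * K s \<cdot>\<close>; its squared pre-Hilbert norm is \<open>\<Sum>s t. c s * c t * K s t\<close>.\<close>

definition fin_coeffs :: "'i set \<Rightarrow> ('i \<Rightarrow> real) set" where
  "fin_coeffs T = {c. finite {s. c s \<noteq> 0} \<and> {s. c s \<noteq> 0} \<subseteq> T}"

definition kernel_comb :: "('i \<Rightarrow> 'i \<Rightarrow> real) \<Rightarrow> ('i \<Rightarrow> real) \<Rightarrow> 'i \<Rightarrow> real" where
  "kernel_comb K c t = (\<Sum>s | c s \<noteq> 0. c s * K s t)"

definition pre_norm :: "('i \<Rightarrow> 'i \<Rightarrow> real) \<Rightarrow> ('i \<Rightarrow> real) \<Rightarrow> real" where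
  "pre_norm K c = sqrt (\<Sum>s | c s \<noteq> 0. \<Sum>t | c t \<noteq> 0. c s * c t * K s t)"

text \<open>The RKHS is the completion of the span of the functions \<open>K s \<cdot>\<close>, realized as a space
  of functions on \<open>T\<close>: an element is the pointwise limit of kernel combinations that are
  Cauchy in the pre-Hilbert norm, and its norm is the limit of their norms (which, for a
  symmetric positive semidefinite \<open>K\<close>, does not depend on the approximating sequence).\<close>

definition rkhs_approx ::
    "'i set \<Rightarrow> ('i \<Rightarrow> 'i \<Rightarrow> real) \<Rightarrow> ('i \<Rightarrow> real) \<Rightarrow> (nat \<Rightarrow> 'i \<Rightarrow> real) \<Rightarrow> bool" where
  "rkhs_approx T K h c \<longleftrightarrow>
     (\<forall>n. c n \<in> fin_coeffs T) \<and>
     (\<forall>e>0. \<exists>N. \<forall>m\<ge>N. \<forall>n\<ge>N. pre_norm K (\<lambda>s. c m s - c n s) < e) \<and>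
     (\<forall>t\<in>T. (\<lambda>n. kernel_comb K (c n) t) \<longlonglongrightarrow> h t)"

definition rkhs :: "'i set \<Rightarrow> ('i \<Rightarrow> 'i \<Rightarrow> real) \<Rightarrow> ('i \<Rightarrow> real) set" where
  "rkhs T K = {h \<in> extensional T. \<exists>c. rkhs_approx T K h c}"

definition rkhs_norm :: "'i set \<Rightarrow> ('i \<Rightarrow> 'i \<Rightarrow> real) \<Rightarrow> ('i \<Rightarrow> real) \<Rightarrow> real" where
  "rkhs_norm T K h = (THE r. \<exists>c. rkhs_approx T K h c \<and> (\<lambda>n. pre_norm K (c n)) \<longlonglongrightarrow> r)"

definition rkhs_unit_ball :: "'i set \<Rightarrow> ('i \<Rightarrow> 'i \<Rightarrow> real) \<Rightarrow> ('i \<Rightarrow> real) set" where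
  "rkhs_unit_ball T K = {h \<in> rkhs T K. rkhs_norm T K h \<le> 1}"

text \<open>The RKHS of a Gaussian process is the one of its covariance kernel.\<close>

definition process_rkhs_unit_ball ::
    "'w measure \<Rightarrow> 'i set \<Rightarrow> ('i \<Rightarrow> 'w \<Rightarrow> real) \<Rightarrow> ('i \<Rightarrow> real) set" where
  "process_rkhs_unit_ball M T W = rkhs_unit_ball T (cov_kernel M W)"


section \<open>Covering numbers for the supremum norm\<close>

definition sup_norm_on :: "'i set \<Rightarrow> ('i \<Rightarrow> real) \<Rightarrow> real" where
  "sup_norm_on T f = (SUP t\<in>T. \<bar>f t\<bar>)"

definition bounded_funs :: "'i set \<Rightarrow> ('i \<Rightarrow> real) set" where
  "bounded_funs T = {f. bounded (f ` T)}"

definition sup_ball :: "'i set \<Rightarrow> ('i \<Rightarrow> real) \<Rightarrow> real \<Rightarrow> ('i \<Rightarrow> real) set" where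
  "sup_ball T g \<epsilon> = {f \<in> bounded_funs T. sup_norm_on T (\<lambda>t. f t - g t) < \<epsilon>}"

text \<open>The centers are arbitrary functions of finite supremum norm; they need not lie in \<open>A\<close>.
  The value is \<open>\<infinity>\<close> if there is no finite cover.\<close>

definition covering_number :: "'i set \<Rightarrow> real \<Rightarrow> ('i \<Rightarrow> real) set \<Rightarrow> enat" where
  "covering_number T \<epsilon> A =
     Inf {enat (card F) |F. finite F \<and> F \<subseteq> bounded_funs T \<and> A \<subseteq> (\<Union>g\<in>F. sup_ball T g \<epsilon>)}"

end

theory Submission
  imports Defs "HOL-Complex_Analysis.Complex_Analysis"
begin

text \<open>
  Functions in the unit ball are analytic at the scale \<open>1 / max a 1\<close>. Hence on an interval whose
  length is a small multiple of this scale, a polynomial of degree of order \<open>ln (1 / \<epsilon>)\<close>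
  approximates them up to \<open>\<epsilon>\<close>. About \<open>max a 1\<close> intervals cover \<open>{0..1}\<close>, so a function is described
  by about \<open>max a 1 * ln (1 / \<epsilon>)\<close> bounded numbers. Each is needed only up to a precision that is a
  power of \<open>\<epsilon>\<close>, which contributes another factor \<open>ln (1 / \<epsilon>)\<close> to the logarithm of the number of
  possibilities. The localization keeps this precision independent of \<open>a\<close>: rounding the coefficients
  of a truncated Fourier series one by one would ask for a precision of order at most \<open>\<epsilon> / a\<close> and so
  bring in \<open>ln a\<close>.

  Analyticity is used for the kernel only, not for the elements of the ball. By Cauchy-Schwarz,
  every \<open>h\<close> in the unit ball satisfies
  \<open>\<bar>\<Sum>i. w i * h (x i)\<bar> \<le> sqrt (\<Sum>i. \<Sum>j. w i * w j * K (x i) (x j))\<close> (lemma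
  \<open>psd_kernel.sampling_bound\<close>). For the single evaluation at \<open>t\<close> this says \<open>\<bar>h t\<bar> \<le> 1\<close>. For the
  error functional of Lagrange interpolation at \<open>n\<close> equispaced nodes it bounds the interpolation
  error of \<open>h\<close> by applying this functional to both variables of the kernel. The kernel is a
  function of \<open>s - t\<close> with a power series at 0 whose coefficients obey Cauchy's inequality
  (\<open>sqexp_periodic_taylor\<close>); the functional kills the Taylor polynomial, and on a short interval the
  remainder decays faster than the exponentially growing norm of interpolation
  (\<open>sum_lagrange_weight_le\<close>). The resulting error is at most a constant times \<open>2 ^ (- n)\<close>
  (\<open>rkhs_unit_ball_interpolation\<close>).

  So a function of the ball is determined up to \<open>\<epsilon> / 4\<close> by its values at the nodes of all
  intervals, and rounding these values yields the finite cover
  (\<open>covering_number_le_of_sampling\<close>).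
\<close>

section \<open>Positive semidefinite kernels and their unit balls\<close>

locale psd_kernel =
  fixes T :: "'i set" and K :: "'i \<Rightarrow> 'i \<Rightarrow> real"
  assumes symmetric: "s \<in> T \<Longrightarrow> t \<in> T \<Longrightarrow> K s t = K t s"
    and nonneg_form: "finite F \<Longrightarrow> F \<subseteq> T \<Longrightarrow> 0 \<le> (\<Sum>s\<in>F. \<Sum>t\<in>F. c s * c t * K s t)"
begin

definition form :: "'i set \<Rightarrow> ('i \<Rightarrow> real) \<Rightarrow> ('i \<Rightarrow> real) \<Rightarrow> real" where
  "form F c d = (\<Sum>s\<in>F. \<Sum>t\<in>F. c s * d t * K s t)"

text \<open>The form may be degenerate, so the case of a null vector \<open>d\<close> is separate; there the
  nonnegative function \<open>x \<mapsto> form F (c + x d) (c + x d)\<close> is affine, hence constant.\<close>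

lemma form_Cauchy_Schwarz:
  assumes F: "finite F" "F \<subseteq> T"
  shows "\<bar>form F c d\<bar> \<le> sqrt (form F c c) * sqrt (form F d d)"
proof -
  let ?p = "form F c c" and ?q = "form F c d" and ?r = "form F d d"
  have comm: "form F d c = ?q"
  proof -
    have "form F d c = (\<Sum>t\<in>F. \<Sum>s\<in>F. d s * c t * K s t)"
      unfolding form_def by (rule sum.swap)
    also have "\<dots> = ?q"
      unfolding form_def using F by (intro sum.cong refl) (auto simp: symmetric subset_iff)
    finally show ?thesis .
  qed
  have expand: "0 \<le> ?p + 2 * x * ?q + x\<^sup>2 * ?r" for x
  proof -
    have "0 \<le> form F (\<lambda>s. c s + x * d s) (\<lambda>s. c s + x * d s)"
      unfolding form_def using F by (rule nonneg_form)
    also have "\<dots> = ?p + x * ?q + x * form F d c + x\<^sup>2 * ?r"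
      unfolding form_def sum_distrib_left sum.distrib[symmetric]
      by (intro sum.cong refl) (simp add: algebra_simps power2_eq_square)
    finally show ?thesis by (simp add: comm)
  qed
  have p: "0 \<le> ?p" and r: "0 \<le> ?r"
    unfolding form_def by (rule nonneg_form[OF F])+
  have "?q\<^sup>2 \<le> ?p * ?r"
  proof (cases "?r = 0")
    case True
    have "?q = 0"
    proof (rule ccontr)
      assume "?q \<noteq> 0"
      then show False
        using expand[of "- (?p + 1) / (2 * ?q)"] p True by (simp add: field_simps)
    qed
    then show ?thesis by (simp add: True)
  next
    case False
    with r have "0 < ?r" by simp
    have "?p + 2 * (- ?q / ?r) * ?q + (- ?q / ?r)\<^sup>2 * ?r = ?p - ?q\<^sup>2 / ?r"
      using False by (simp add: power2_eq_square)
    then have "?q\<^sup>2 / ?r \<le> ?p" using expand[of "- ?q / ?r"] by simp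
    then show ?thesis using \<open>0 < ?r\<close> by (simp add: divide_le_eq)
  qed
  then have "sqrt (?q\<^sup>2) \<le> sqrt (?p * ?r)" by (rule real_sqrt_le_mono)
  then show ?thesis by (simp add: real_sqrt_mult)
qed

lemma form_support:
  assumes "finite F" "{s. c s \<noteq> 0} \<subseteq> F" "{s. d s \<noteq> 0} \<subseteq> F"
  shows "form F c d = (\<Sum>s | c s \<noteq> 0. \<Sum>t | d t \<noteq> 0. c s * d t * K s t)"
proof -
  have "(\<Sum>t\<in>F. c s * d t * K s t) = (\<Sum>t | d t \<noteq> 0. c s * d t * K s t)" for s
    using assms by (intro sum.mono_neutral_right) auto
  then have "form F c d = (\<Sum>s\<in>F. \<Sum>t | d t \<noteq> 0. c s * d t * K s t)"
    by (simp add: form_def)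
  also have "\<dots> = (\<Sum>s | c s \<noteq> 0. \<Sum>t | d t \<noteq> 0. c s * d t * K s t)"
    using assms by (intro sum.mono_neutral_right) auto
  finally show ?thesis .
qed

lemma pre_norm_eq_form:
  assumes "finite F" "{s. c s \<noteq> 0} \<subseteq> F"
  shows "pre_norm K c = sqrt (form F c c)"
  using assms by (simp add: pre_norm_def form_support)

lemma pre_norm_nonneg: "c \<in> fin_coeffs T \<Longrightarrow> 0 \<le> pre_norm K c"
  unfolding pre_norm_def fin_coeffs_def by (intro real_sqrt_ge_zero nonneg_form) auto

lemma kernel_comb_eq_form:
  assumes "finite F" "F \<subseteq> T" "{s. c s \<noteq> 0} \<subseteq> F"
  shows "(\<Sum>t\<in>F. d t * kernel_comb K c t) = form F c d"
proof -
  have "kernel_comb K c t = (\<Sum>s\<in>F. c s * K s t)" for t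
    unfolding kernel_comb_def using assms by (intro sum.mono_neutral_left) auto
  then have "(\<Sum>t\<in>F. d t * kernel_comb K c t) = (\<Sum>t\<in>F. \<Sum>s\<in>F. c s * d t * K s t)"
    by (simp add: sum_distrib_left mult_ac)
  also have "\<dots> = form F c d" unfolding form_def by (rule sum.swap)
  finally show ?thesis .
qed

text \<open>A functional \<open>h \<mapsto> \<Sum>i. w i * h (x i)\<close> may use the same point \<open>x i\<close> for several indices
  \<open>i\<close> (an interpolation error evaluates twice at a node when its argument is one). Adding up the
  weights over each point turns it into a coefficient function on points.\<close>

definition collect_weights :: "'j set \<Rightarrow> ('j \<Rightarrow> 'i) \<Rightarrow> ('j \<Rightarrow> real) \<Rightarrow> 'i \<Rightarrow> real" where
  "collect_weights I x w s = (\<Sum>i | i \<in> I \<and> x i = s. w i)"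

lemma sum_collect_weights:
  assumes "finite I" "finite F" "x ` I \<subseteq> F"
  shows "(\<Sum>s\<in>F. collect_weights I x w s * f s) = (\<Sum>i\<in>I. w i * f (x i))"
proof -
  have "(\<Sum>s\<in>F. collect_weights I x w s * f s) = (\<Sum>s\<in>F. \<Sum>i | i \<in> I \<and> x i = s. w i * f (x i))"
    unfolding collect_weights_def sum_distrib_right by (intro sum.cong refl) auto
  also have "\<dots> = (\<Sum>i\<in>I. w i * f (x i))"
    using assms by (intro sum.group) auto
  finally show ?thesis .
qed

lemma form_collect_weights:
  assumes "finite I" "finite F" "x ` I \<subseteq> F"
  shows "form F (collect_weights I x w) (collect_weights I x w)
    = (\<Sum>i\<in>I. \<Sum>j\<in>I. w i * w j * K (x i) (x j))"
proof -
  let ?d = "collect_weights I x w"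
  have "form F ?d ?d = (\<Sum>s\<in>F. ?d s * (\<Sum>t\<in>F. ?d t * K s t))"
    by (simp add: form_def sum_distrib_left mult_ac)
  also have "\<dots> = (\<Sum>i\<in>I. w i * (\<Sum>j\<in>I. w j * K (x i) (x j)))"
    by (simp only: sum_collect_weights[OF assms])
  also have "\<dots> = (\<Sum>i\<in>I. \<Sum>j\<in>I. w i * w j * K (x i) (x j))"
    by (simp add: sum_distrib_left mult_ac)
  finally show ?thesis .
qed

text \<open>A linear combination of point evaluations is the inner product with the corresponding
  combination of the functions \<open>K (x i)\<close>, so Cauchy-Schwarz bounds it by the product of the two norms.\<close>

lemma sampling_bound_kernel_comb:
  fixes w :: "'j \<Rightarrow> real"
  assumes c: "c \<in> fin_coeffs T" and I: "finite I" and x: "x ` I \<subseteq> T"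
  shows "\<bar>\<Sum>i\<in>I. w i * kernel_comb K c (x i)\<bar>
    \<le> pre_norm K c * sqrt (\<Sum>i\<in>I. \<Sum>j\<in>I. w i * w j * K (x i) (x j))"
proof -
  define F where "F = {s. c s \<noteq> 0} \<union> x ` I"
  have F: "finite F" "F \<subseteq> T" "{s. c s \<noteq> 0} \<subseteq> F" "x ` I \<subseteq> F"
    using c I x by (auto simp: F_def fin_coeffs_def)
  have "(\<Sum>i\<in>I. w i * kernel_comb K c (x i)) = form F c (collect_weights I x w)"
    using kernel_comb_eq_form[OF F(1-3), of "collect_weights I x w"]
      sum_collect_weights[OF I F(1,4), of w "kernel_comb K c"] by simp
  then show ?thesis
    using form_Cauchy_Schwarz[OF F(1,2), of c "collect_weights I x w"]
      pre_norm_eq_form[OF F(1,3)] form_collect_weights[OF I F(1,4), of w] by simp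
qed

text \<open>Only finitely many values of \<open>h\<close> occur, so the bound survives pointwise limits. This is
  why all later arguments use point evaluations and never derivatives of \<open>h\<close>.\<close>

lemma sampling_bound_limit:
  fixes w :: "'j \<Rightarrow> real"
  assumes h: "rkhs_approx T K h c" and r: "(\<lambda>n. pre_norm K (c n)) \<longlonglongrightarrow> r"
    and I: "finite I" and x: "x ` I \<subseteq> T"
  shows "\<bar>\<Sum>i\<in>I. w i * h (x i)\<bar> \<le> r * sqrt (\<Sum>i\<in>I. \<Sum>j\<in>I. w i * w j * K (x i) (x j))"
proof (rule LIMSEQ_le)
  show "(\<lambda>n. \<bar>\<Sum>i\<in>I. w i * kernel_comb K (c n) (x i)\<bar>) \<longlonglongrightarrow> \<bar>\<Sum>i\<in>I. w i * h (x i)\<bar>"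
    using h x unfolding rkhs_approx_def by (intro tendsto_intros) auto
  show "(\<lambda>n. pre_norm K (c n) * sqrt (\<Sum>i\<in>I. \<Sum>j\<in>I. w i * w j * K (x i) (x j))) \<longlonglongrightarrow>
      r * sqrt (\<Sum>i\<in>I. \<Sum>j\<in>I. w i * w j * K (x i) (x j))"
    by (intro tendsto_intros r)
  show "\<exists>N. \<forall>n\<ge>N. \<bar>\<Sum>i\<in>I. w i * kernel_comb K (c n) (x i)\<bar>
      \<le> pre_norm K (c n) * sqrt (\<Sum>i\<in>I. \<Sum>j\<in>I. w i * w j * K (x i) (x j))"
    using h sampling_bound_kernel_comb[OF _ I x] unfolding rkhs_approx_def by simp
qed

lemma pre_norm_triangle:
  assumes "c \<in> fin_coeffs T" "d \<in> fin_coeffs T"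
  shows "\<bar>pre_norm K c - pre_norm K d\<bar> \<le> pre_norm K (\<lambda>s. c s - d s)"
proof -
  define F where "F = {s. c s \<noteq> 0} \<union> {s. d s \<noteq> 0}"
  have F: "finite F" "F \<subseteq> T" "{s. c s \<noteq> 0} \<subseteq> F" "{s. d s \<noteq> 0} \<subseteq> F" "{s. c s - d s \<noteq> 0} \<subseteq> F"
    using assms by (auto simp: F_def fin_coeffs_def)
  note norms = pre_norm_eq_form[OF F(1,3)] pre_norm_eq_form[OF F(1,4)] pre_norm_eq_form[OF F(1,5)]
  have pos: "0 \<le> form F u u" for u
    unfolding form_def using F(1,2) by (rule nonneg_form)
  have "form F (\<lambda>s. c s - d s) (\<lambda>s. c s - d s) = form F c c - form F c d - form F d c + form F d d"
    unfolding form_def sum_subtractf[symmetric] sum.distrib[symmetric]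
    by (intro sum.cong refl) (simp add: algebra_simps)
  moreover have "form F c d \<le> sqrt (form F c c) * sqrt (form F d d)"
    "form F d c \<le> sqrt (form F c c) * sqrt (form F d d)"
    using form_Cauchy_Schwarz[OF F(1,2), of c d] form_Cauchy_Schwarz[OF F(1,2), of d c]
    by (simp_all add: mult.commute)
  ultimately have "(sqrt (form F c c) - sqrt (form F d d))\<^sup>2 \<le> form F (\<lambda>s. c s - d s) (\<lambda>s. c s - d s)"
    using pos[of c] pos[of d] by (simp add: power2_diff)
  then have "\<bar>sqrt (form F c c) - sqrt (form F d d)\<bar> \<le> sqrt (form F (\<lambda>s. c s - d s) (\<lambda>s. c s - d s))"
    by (metis real_sqrt_le_mono real_sqrt_abs)
  then show ?thesis by (simp only: norms)
qed

lemma pre_norm_convergent: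
  assumes h: "rkhs_approx T K h c"
  shows "convergent (\<lambda>n. pre_norm K (c n))"
proof (rule Cauchy_convergent, rule metric_CauchyI)
  fix e :: real assume "0 < e"
  then obtain N where N: "\<And>m n. m \<ge> N \<Longrightarrow> n \<ge> N \<Longrightarrow> pre_norm K (\<lambda>s. c m s - c n s) < e"
    using h unfolding rkhs_approx_def by meson
  then show "\<exists>M. \<forall>m\<ge>M. \<forall>n\<ge>M. dist (pre_norm K (c m)) (pre_norm K (c n)) < e"
  proof (intro exI allI impI)
    fix m n assume "N \<le> m" "N \<le> n"
    then show "dist (pre_norm K (c m)) (pre_norm K (c n)) < e"
      using h pre_norm_triangle[of "c m" "c n"] N[of m n]
      unfolding rkhs_approx_def dist_real_def by force
  qed
qed

text \<open>Two sequences that approximate the same \<open>h\<close> have the same limit norm. Testing \<open>h\<close> against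
  the weights \<open>c' N\<close> gives at most \<open>r * pre_norm K (c' N)\<close> by the previous bound along \<open>c\<close>. On the
  other hand, along \<open>c'\<close> itself, the value is within \<open>e * pre_norm K (c' N)\<close> of the square of
  \<open>pre_norm K (c' N)\<close>, because \<open>c'\<close> is Cauchy. Hence \<open>r' * r' \<le> r * r'\<close> in the limit.\<close>

lemma pre_norm_limit_le:
  assumes h: "rkhs_approx T K h c" and r: "(\<lambda>n. pre_norm K (c n)) \<longlonglongrightarrow> r"
    and h': "rkhs_approx T K h c'" and r': "(\<lambda>n. pre_norm K (c' n)) \<longlonglongrightarrow> r'"
  shows "r' \<le> r"
proof -
  have fin: "c' n \<in> fin_coeffs T" for n
    using h' by (simp add: rkhs_approx_def)
  have "r \<ge> 0"
    using r h pre_norm_nonneg unfolding rkhs_approx_def by (auto intro: LIMSEQ_le_const)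
  have "r' \<ge> 0"
    using r' fin pre_norm_nonneg by (auto intro: LIMSEQ_le_const)
  have dual: "\<bar>\<Sum>s | c' N s \<noteq> 0. c' N s * h s\<bar> \<le> r * pre_norm K (c' N)" for N
    unfolding pre_norm_def using fin[of N]
    by (intro sampling_bound_limit[OF h r, where x = "\<lambda>s. s"]) (auto simp: fin_coeffs_def)
  have self: "(pre_norm K (c' N))\<^sup>2 - e * pre_norm K (c' N) \<le> r * pre_norm K (c' N)"
    if N: "\<And>n. n \<ge> N \<Longrightarrow> pre_norm K (\<lambda>s. c' n s - c' N s) < e" for N e
  proof (rule order_trans[OF LIMSEQ_le_const])
    let ?S = "{s. c' N s \<noteq> 0}"
    show "(\<lambda>n. \<Sum>s\<in>?S. c' N s * kernel_comb K (c' n) s) \<longlonglongrightarrow> (\<Sum>s\<in>?S. c' N s * h s)"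
      using h' fin[of N] unfolding rkhs_approx_def fin_coeffs_def
      by (intro tendsto_sum tendsto_mult tendsto_const) blast
    show "(\<Sum>s\<in>?S. c' N s * h s) \<le> r * pre_norm K (c' N)"
      using dual[of N] by linarith
    \<comment> \<open>Past \<open>N\<close> the Cauchy property bounds the inner product of \<open>c' n - c' N\<close> with \<open>c' N\<close>.\<close>
    have "(pre_norm K (c' N))\<^sup>2 - e * pre_norm K (c' N) \<le> (\<Sum>s\<in>?S. c' N s * kernel_comb K (c' n) s)"
      if "n \<ge> N" for n
    proof -
      define F where "F = {s. c' n s \<noteq> 0} \<union> ?S"
      have F: "finite F" "F \<subseteq> T" "?S \<subseteq> F" "{s. c' n s \<noteq> 0} \<subseteq> F" "{s. c' n s - c' N s \<noteq> 0} \<subseteq> F"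
        using fin[of N] fin[of n] by (auto simp: F_def fin_coeffs_def)
      have "(\<Sum>s\<in>?S. c' N s * kernel_comb K (c' n) s) = (\<Sum>s\<in>F. c' N s * kernel_comb K (c' n) s)"
        using F by (intro sum.mono_neutral_left) auto
      also have "\<dots> = form F (c' n) (c' N)"
        by (rule kernel_comb_eq_form[OF F(1,2,4)])
      also have "\<dots> = form F (\<lambda>s. c' n s - c' N s) (c' N) + form F (c' N) (c' N)"
        unfolding form_def sum.distrib[symmetric]
        by (intro sum.cong refl) (simp add: algebra_simps)
      finally have eq: "(\<Sum>s\<in>?S. c' N s * kernel_comb K (c' n) s) =
        form F (\<lambda>s. c' n s - c' N s) (c' N) + form F (c' N) (c' N)" .
      have "form F (c' N) (c' N) = (pre_norm K (c' N))\<^sup>2"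
        using pre_norm_eq_form[OF F(1,3)] nonneg_form[OF F(1,2), of "c' N"]
        by (simp add: form_def)
      moreover have "\<bar>form F (\<lambda>s. c' n s - c' N s) (c' N)\<bar> \<le> e * pre_norm K (c' N)"
      proof -
        have "pre_norm K (\<lambda>s. c' n s - c' N s) * pre_norm K (c' N) \<le> e * pre_norm K (c' N)"
          using N[OF that] pre_norm_nonneg[OF fin[of N]] by (intro mult_right_mono) auto
        then show ?thesis
          using form_Cauchy_Schwarz[OF F(1,2), of "\<lambda>s. c' n s - c' N s" "c' N"]
            pre_norm_eq_form[OF F(1,3)] pre_norm_eq_form[OF F(1,5)] by simp
      qed
      ultimately show ?thesis using eq by linarith
    qed
    then show "\<exists>N'. \<forall>n\<ge>N'. (pre_norm K (c' N))\<^sup>2 - e * pre_norm K (c' N)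
        \<le> (\<Sum>s\<in>?S. c' N s * kernel_comb K (c' n) s)"
      by blast
  qed
  have "r'\<^sup>2 - e * r' \<le> r * r'" if "e > 0" for e
  proof (rule LIMSEQ_le)
    show "(\<lambda>N. (pre_norm K (c' N))\<^sup>2 - e * pre_norm K (c' N)) \<longlonglongrightarrow> r'\<^sup>2 - e * r'"
      by (intro tendsto_intros r')
    show "(\<lambda>N. r * pre_norm K (c' N)) \<longlonglongrightarrow> r * r'"
      by (intro tendsto_intros r')
    obtain N0 where "\<And>m n. m \<ge> N0 \<Longrightarrow> n \<ge> N0 \<Longrightarrow> pre_norm K (\<lambda>s. c' m s - c' n s) < e"
      using h' \<open>e > 0\<close> unfolding rkhs_approx_def by meson
    then have "(pre_norm K (c' N))\<^sup>2 - e * pre_norm K (c' N) \<le> r * pre_norm K (c' N)"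
      if "N \<ge> N0" for N
      using self[of N e] that order_trans by blast
    then show "\<exists>N0. \<forall>N\<ge>N0. (pre_norm K (c' N))\<^sup>2 - e * pre_norm K (c' N) \<le> r * pre_norm K (c' N)"
      by blast
  qed
  then have "r' * (r' - r) \<le> e * r'" if "e > 0" for e
    using that by (simp add: algebra_simps power2_eq_square)
  then have le: "r' - r \<le> e" if "e > 0" "r' > 0" for e
    using that by (simp add: mult.commute)
  show ?thesis
  proof (cases "r' = 0")
    case False
    with \<open>r' \<ge> 0\<close> have "r' > 0" by simp
    then show ?thesis using le field_le_epsilon[of r' r] by (simp add: algebra_simps)
  qed (use \<open>r \<ge> 0\<close> in simp)
qed

text \<open>The definite description in the definition of the norm therefore denotes the expected limit.\<close>

lemma rkhs_norm_eq_limit: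
  assumes "rkhs_approx T K h c" and "(\<lambda>n. pre_norm K (c n)) \<longlonglongrightarrow> r"
  shows "rkhs_norm T K h = r"
  unfolding rkhs_norm_def
proof (rule the_equality)
  show "\<exists>c. rkhs_approx T K h c \<and> (\<lambda>n. pre_norm K (c n)) \<longlonglongrightarrow> r"
    using assms by blast
  fix r' assume "\<exists>c. rkhs_approx T K h c \<and> (\<lambda>n. pre_norm K (c n)) \<longlonglongrightarrow> r'"
  then obtain c' where c': "rkhs_approx T K h c'" "(\<lambda>n. pre_norm K (c' n)) \<longlonglongrightarrow> r'"
    by blast
  show "r' = r"
    using pre_norm_limit_le[OF assms c'] pre_norm_limit_le[OF c' assms] by simp
qed

text \<open>The only property of the unit ball that the covering argument uses. The root on the right is
  the dual norm of the functional on the left, computed from the kernel alone.\<close>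

lemma sampling_bound:
  fixes w :: "'j \<Rightarrow> real"
  assumes h: "h \<in> rkhs_unit_ball T K" and I: "finite I" and x: "x ` I \<subseteq> T"
  shows "\<bar>\<Sum>i\<in>I. w i * h (x i)\<bar> \<le> sqrt (\<Sum>i\<in>I. \<Sum>j\<in>I. w i * w j * K (x i) (x j))"
proof -
  obtain c where c: "rkhs_approx T K h c" and le: "rkhs_norm T K h \<le> 1"
    using h by (auto simp: rkhs_unit_ball_def rkhs_def)
  obtain r where r: "(\<lambda>n. pre_norm K (c n)) \<longlonglongrightarrow> r"
    using pre_norm_convergent[OF c] by (auto simp: convergent_def)
  have "r \<le> 1" using rkhs_norm_eq_limit[OF c r] le by simp
  have bound: "\<bar>\<Sum>i\<in>I. w i * h (x i)\<bar> \<le> r * sqrt (\<Sum>i\<in>I. \<Sum>j\<in>I. w i * w j * K (x i) (x j))"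
    by (rule sampling_bound_limit[OF c r I x])
  let ?q = "sqrt (\<Sum>i\<in>I. \<Sum>j\<in>I. w i * w j * K (x i) (x j))"
  have "0 \<le> ?q"
    using form_collect_weights[OF I finite_imageI[OF I] order_refl, of x w]
      nonneg_form[OF finite_imageI[OF I] x, of "collect_weights I x w"]
    by (simp add: form_def)
  then have "r * ?q \<le> 1 * ?q" using \<open>r \<le> 1\<close> by (intro mult_right_mono)
  then show ?thesis using bound by linarith
qed

end

section \<open>Lagrange interpolation at integer nodes\<close>

definition lagrange_weight :: "nat \<Rightarrow> nat \<Rightarrow> real \<Rightarrow> real" where
  "lagrange_weight n i x = (\<Prod>j\<in>{..<n} - {i}. (x - real j) / (real i - real j))"

text \<open>Both sides are polynomials in \<open>x\<close> of degree less than \<open>n\<close> that agree at the \<open>n\<close> nodes.\<close>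

lemma lagrange_weight_reproduces:
  fixes p :: "real poly"
  assumes deg: "degree p < n"
  shows "(\<Sum>i<n. lagrange_weight n i x * poly p (real i)) = poly p x"
proof -
  \<comment> \<open>The weights as polynomials, and their interpolation polynomial \<open>q\<close> for the values of \<open>p\<close>.\<close>
  define L where "L i = (\<Prod>j\<in>{..<n} - {i}. smult (1 / (real i - real j)) [:- real j, 1:])" for i
  have L: "poly (L i) y = lagrange_weight n i y" for i y
    by (simp add: L_def lagrange_weight_def poly_prod diff_divide_distrib)
  define q where "q = (\<Sum>i<n. smult (poly p (real i)) (L i))"
  have q: "poly q y = (\<Sum>i<n. lagrange_weight n i y * poly p (real i))" for y
    by (simp add: q_def poly_sum L mult.commute)
  have "degree (L i) < n" if "i < n" for i
  proof -
    have "degree (L i) \<le> sum (degree \<circ> (\<lambda>j. smult (1 / (real i - real j)) [:- real j, 1:])) ({..<n} - {i})"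
      unfolding L_def by (rule degree_prod_sum_le) simp
    also have "\<dots> \<le> (\<Sum>j\<in>{..<n} - {i}. 1)"
      by (intro sum_mono) (simp add: degree_smult_le)
    also have "\<dots> < n" using that by simp
    finally show ?thesis .
  qed
  moreover have "n > 0" using deg by simp
  ultimately have degq: "degree q < n"
    unfolding q_def by (intro degree_sum_less) (auto intro: le_less_trans[OF degree_smult_le])
  have node: "lagrange_weight n i (real k) = (if i = k then 1 else 0)" if "k < n" for i k
  proof (cases "i = k")
    case True
    then show ?thesis by (auto simp: lagrange_weight_def intro!: prod.neutral)
  next
    case False
    then have "lagrange_weight n i (real k) = 0"
      unfolding lagrange_weight_def using that by (intro prod_zero) auto
    then show ?thesis using False by simp
  qed
  have "q = p"
  proof (rule poly_eqI_degree[where A = "real ` {..<n}"])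
    show "poly q y = poly p y" if "y \<in> real ` {..<n}" for y
    proof -
      obtain k where k: "k < n" "y = real k" using \<open>y \<in> real ` {..<n}\<close> by auto
      have "poly q y = (\<Sum>i<n. if i = k then poly p (real k) else 0)"
        unfolding q k(2) node[OF k(1)] by (intro sum.cong) auto
      then show ?thesis using k by simp
    qed
  qed (use deg degq in \<open>simp_all add: card_image\<close>)
  then show ?thesis using q[of x] by simp
qed

lemma prod_node_distances:
  assumes "i < n"
  shows "(\<Prod>j\<in>{..<n} - {i}. \<bar>real i - real j\<bar>) = fact i * fact (n - 1 - i)"
proof -
  have split: "{..<n} - {i} = {..<i} \<union> {i<..<n}" using assms by auto
  have "(\<Prod>j<i. \<bar>real i - real j\<bar>) = (\<Prod>j\<in>{1..i}. real j)"
    by (rule prod.reindex_bij_witness[of _ "\<lambda>j. i - j" "\<lambda>j. i - j"]) auto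
  moreover have "(\<Prod>j\<in>{i<..<n}. \<bar>real i - real j\<bar>) = (\<Prod>j\<in>{1..n - 1 - i}. real j)"
    by (rule prod.reindex_bij_witness[of _ "\<lambda>j. i + j" "\<lambda>j. j - i"]) auto
  ultimately show ?thesis
    unfolding split by (subst prod.union_disjoint) (auto simp: fact_prod)
qed

lemma power_le_exp_fact: "real n ^ k \<le> exp (real n) * fact k"
proof -
  have "real n ^ k / fact k \<le> exp (real n)"
    using sum_le_suminf[OF summable_exp_generic[of "real n"], of "{k}"]
    by (simp add: exp_def divide_inverse mult.commute)
  then show ?thesis by (simp add: field_simps)
qed

text \<open>The Lebesgue constant of equispaced nodes grows exponentially. Any base is good enough here,
  because the power series of the kernel will be evaluated so deep inside its disc of convergence
  that its remainders decay with a larger base. The base 6 is \<open>2 * 3\<close>: the binomial coefficients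
  \<open>k choose i\<close> contribute \<open>2 ^ k\<close>, and \<open>n ^ k / k!\<close> contributes at most \<open>exp n \<le> 3 ^ n\<close>.\<close>

lemma sum_lagrange_weight_le:
  assumes x: "0 \<le> x" "x \<le> real n"
  shows "(\<Sum>i<n. \<bar>lagrange_weight n i x\<bar>) \<le> 6 ^ n"
proof (cases "n = 0")
  case False
  define k where "k = n - 1"
  have n: "n = Suc k" using False by (simp add: k_def)
  have w: "\<bar>lagrange_weight n i x\<bar> \<le> real n ^ k / fact k * real (k choose i)" if "i \<le> k" for i
  proof -
    have "\<bar>lagrange_weight n i x\<bar>
        = (\<Prod>j\<in>{..<n} - {i}. \<bar>x - real j\<bar>) / (\<Prod>j\<in>{..<n} - {i}. \<bar>real i - real j\<bar>)"
      by (simp add: lagrange_weight_def abs_prod prod_dividef)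
    also have "(\<Prod>j\<in>{..<n} - {i}. \<bar>real i - real j\<bar>) = fact i * fact (k - i)"
      using prod_node_distances[of i n] that n by simp
    also have "(\<Prod>j\<in>{..<n} - {i}. \<bar>x - real j\<bar>) / (fact i * fact (k - i))
        \<le> (\<Prod>j\<in>{..<n} - {i}. real n) / (fact i * fact (k - i))"
      using x by (intro divide_right_mono prod_mono) auto
    also have "(\<Prod>j\<in>{..<n} - {i}. real n) = real n ^ k"
      using that n by simp
    also have "real n ^ k / (fact i * fact (k - i)) = real n ^ k / fact k * real (k choose i)"
      using binomial_fact[OF that, where 'a = real] by simp
    finally show ?thesis .
  qed
  have "(\<Sum>i<n. \<bar>lagrange_weight n i x\<bar>) \<le> (\<Sum>i\<le>k. real n ^ k / fact k * real (k choose i))"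
    unfolding n lessThan_Suc_atMost using w n by (intro sum_mono) auto
  also have "\<dots> = real n ^ k / fact k * 2 ^ k"
    unfolding sum_distrib_left[symmetric] of_nat_sum[symmetric] choose_row_sum by simp
  also have "\<dots> \<le> exp (real n) * 2 ^ n"
    using power_le_exp_fact[of n k] n
    by (intro mult_mono) (simp_all add: divide_le_eq)
  also have "\<dots> \<le> 3 ^ n * 2 ^ n"
    using exp_le exp_of_nat_mult[of n "1::real"] by (simp add: power_mono)
  also have "\<dots> = (6::real) ^ n" by (simp flip: power_mult_distrib)
  finally show ?thesis .
qed simp

section \<open>The power series of the kernel\<close>

lemma norm_sin_le:
  fixes z :: complex
  assumes "norm z \<le> 1"
  shows "norm (sin z) \<le> 3 * norm z"
proof -
  have "norm (sin z - sin 0) \<le> 3 * norm (z - 0)"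
  proof (rule field_differentiable_bound[where S = "cball 0 1" and f = sin and f' = cos])
    show "norm (cos w) \<le> 3" if "w \<in> cball 0 1" for w :: complex
    proof -
      have "norm (exp (\<i> * w)) \<le> 3" "norm (exp (- (\<i> * w))) \<le> 3"
        using that norm_exp[of "\<i> * w"] norm_exp[of "- (\<i> * w)"] exp_le
        by (auto simp: norm_mult intro: order_trans)
      then show ?thesis
        using norm_triangle_ineq[of "exp (\<i> * w)" "exp (- (\<i> * w))"]
        by (simp add: cos_exp_eq norm_divide)
    qed
  qed (use assms in \<open>auto intro!: derivative_eq_intros\<close>)
  then show ?thesis by simp
qed

text \<open>The kernel as a function of the complex time difference \<open>z\<close> is entire, and it is bounded by an
  absolute constant on a disc of radius proportional to \<open>1 / max a 1\<close>, since there \<open>a * sin (\<pi> z)\<close>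
  has absolute value at most 3, so that the exponent is at most 36. Cauchy's inequality then controls all Taylor coefficients at 0. This radius is the
  source of the factor \<open>max a 1\<close> in the entropy bound.\<close>

lemma sqexp_periodic_taylor:
  assumes a: "0 < a"
  defines "\<rho> \<equiv> 1 / (pi * max a 1)"
  shows "\<exists>b :: nat \<Rightarrow> real. (\<forall>k. \<bar>b k\<bar> \<le> exp 36 / \<rho> ^ k) \<and>
    (\<forall>u. \<bar>u\<bar> < \<rho> \<longrightarrow> (\<lambda>k. b k * u ^ k) sums exp (- 4 * a\<^sup>2 * (sin (pi * u))\<^sup>2))"
proof -
  define f :: "complex \<Rightarrow> complex" where
    "f z = exp (- 4 * of_real (a\<^sup>2) * (sin (of_real pi * z))\<^sup>2)" for z
  have \<rho>: "\<rho> > 0" by (simp add: \<rho>_def)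
  have hol: "f holomorphic_on A" for A
    unfolding f_def by (intro holomorphic_intros)
  have bound: "norm (f z) \<le> exp 36" if z: "norm z = \<rho>" for z
  proof -
    \<comment> \<open>The radius makes the argument of the sine at most 1 and at most \<open>1 / a\<close>.\<close>
    have pz: "norm (of_real pi * z) = 1 / max a 1"
      using z by (simp add: norm_mult \<rho>_def)
    have "norm (sin (of_real pi * z)) \<le> 3 * (1 / max a 1)"
      using norm_sin_le[of "of_real pi * z"] unfolding pz by simp
    then have "a * norm (sin (of_real pi * z)) \<le> a * (3 * (1 / max a 1))"
      using a by (intro mult_left_mono) auto
    also have "\<dots> \<le> 3" using a by (simp add: field_simps)
    finally have "(a * norm (sin (of_real pi * z)))\<^sup>2 \<le> 3\<^sup>2"
      using a by (intro power_mono) auto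
    then have "norm (- 4 * of_real (a\<^sup>2) * (sin (of_real pi * z))\<^sup>2) \<le> 36"
      by (simp add: norm_mult norm_power power_mult_distrib)
    then show ?thesis
      unfolding f_def using norm_exp exp_le_cancel_iff order_trans by blast
  qed
  define b where "b k = Re ((deriv ^^ k) f 0 / fact k)" for k
  have "\<bar>b k\<bar> \<le> exp 36 / \<rho> ^ k" for k
  proof -
    have "norm ((deriv ^^ k) f 0) \<le> fact k * exp 36 / \<rho> ^ k"
      by (rule Cauchy_inequality) (use \<rho> bound hol in \<open>auto intro: holomorphic_on_imp_continuous_on\<close>)
    then have "norm ((deriv ^^ k) f 0 / fact k) \<le> exp 36 / \<rho> ^ k"
      by (simp add: norm_divide field_simps)
    then show ?thesis
      unfolding b_def using abs_Re_le_cmod order_trans by blast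
  qed
  moreover have "(\<lambda>k. b k * u ^ k) sums exp (- 4 * a\<^sup>2 * (sin (pi * u))\<^sup>2)" if "\<bar>u\<bar> < \<rho>" for u
  proof -
    have "(\<lambda>k. (deriv ^^ k) f 0 / fact k * (of_real u - 0) ^ k) sums f (of_real u)"
      using that by (intro holomorphic_power_series[where r = \<rho>] hol) simp
    from sums_Re[OF this]
    have "(\<lambda>k. Re ((deriv ^^ k) f 0 / fact k * of_real (u ^ k))) sums Re (f (of_real u))"
      by simp
    moreover have "Re (w * of_real (u ^ k)) = Re w * u ^ k" for w :: complex and k
      by simp
    moreover have "f (of_real u) = of_real (exp (- 4 * a\<^sup>2 * (sin (pi * u))\<^sup>2))"
    proof -
      have "sin (of_real pi * of_real u :: complex) = of_real (sin (pi * u))"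
        by (simp flip: of_real_mult sin_of_real)
      then show ?thesis by (simp add: f_def flip: exp_of_real)
    qed
    ultimately show ?thesis unfolding b_def by (simp only: Re_complex_of_real)
  qed
  ultimately show ?thesis by blast
qed

lemma power_series_tail_bound:
  fixes b :: "nat \<Rightarrow> real"
  assumes b: "\<And>k. \<bar>b k\<bar> \<le> B / \<rho> ^ k" and B: "0 \<le> B" and \<rho>: "0 < \<rho>" and q: "0 \<le> q" "q \<le> 1 / 2"
    and u: "\<bar>u\<bar> \<le> q * \<rho>" and sums: "(\<lambda>k. b k * u ^ k) sums S"
  shows "\<bar>S - (\<Sum>k<n. b k * u ^ k)\<bar> \<le> 2 * B * q ^ n"
proof -
  have coeff: "\<bar>b k * u ^ k\<bar> \<le> B * q ^ k" for k
  proof -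
    have "\<bar>b k * u ^ k\<bar> \<le> B / \<rho> ^ k * (q * \<rho>) ^ k"
      unfolding abs_mult power_abs using b u B \<rho> by (intro mult_mono power_mono) auto
    also have "\<dots> = B * q ^ k" using \<rho> by (simp add: power_mult_distrib)
    finally show ?thesis .
  qed
  have geo: "(\<lambda>k. B * q ^ (k + n)) sums (B * q ^ n * (1 / (1 - q)))"
    using sums_mult[OF geometric_sums[of q], of "B * q ^ n"] q
    by (simp add: power_add mult_ac)
  have tail: "(\<lambda>k. b (k + n) * u ^ (k + n)) sums (S - (\<Sum>k<n. b k * u ^ k))"
    using sums by (subst sums_iff_shift) simp
  have "\<bar>S - (\<Sum>k<n. b k * u ^ k)\<bar> \<le> B * q ^ n * (1 / (1 - q))"
    using norm_suminf_le[of "\<lambda>k. b (k + n) * u ^ (k + n)" "\<lambda>k. B * q ^ (k + n)"] coeff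
      sums_unique[OF tail] sums_unique[OF geo] sums_summable[OF geo]
    by simp
  also have "\<dots> \<le> B * q ^ n * 2"
    using q B by (intro mult_left_mono) (auto simp: field_simps)
  finally show ?thesis by simp
qed
section \<open>Covering by rounded samples\<close>

text \<open>If every function of \<open>A\<close> is recovered up to \<open>\<epsilon> / 4\<close> by a fixed linear formula from its
  values at the points \<open>x j\<close>, then rounding these values to multiples of \<open>\<epsilon> / (4 * L)\<close> costs at
  most another \<open>\<epsilon> / 4\<close>, and there are only finitely many tuples of rounded values.\<close>

lemma covering_number_le_of_sampling:
  fixes A :: "('i \<Rightarrow> real) set" and wt :: "'i \<Rightarrow> 'j \<Rightarrow> real" and x :: "'j \<Rightarrow> 'i"
  assumes T: "T \<noteq> {}" and J: "finite J" "x ` J \<subseteq> T"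
    and \<epsilon>: "0 < \<epsilon>" and L: "0 < L"
    and bounded: "\<And>h t. h \<in> A \<Longrightarrow> t \<in> T \<Longrightarrow> \<bar>h t\<bar> \<le> 1"
    and weights: "\<And>t. t \<in> T \<Longrightarrow> (\<Sum>j\<in>J. \<bar>wt t j\<bar>) \<le> L"
    and approx: "\<And>h t. h \<in> A \<Longrightarrow> t \<in> T \<Longrightarrow> \<bar>h t - (\<Sum>j\<in>J. wt t j * h (x j))\<bar> \<le> \<epsilon> / 4"
  shows "covering_number T \<epsilon> A \<le> enat (nat (2 * \<lceil>4 * L / \<epsilon>\<rceil> + 1) ^ card J)"
proof -
  define \<eta> where "\<eta> = \<epsilon> / (4 * L)"
  define G where "G = \<lceil>4 * L / \<epsilon>\<rceil>"
  have \<eta>: "\<eta> > 0" using \<epsilon> L by (simp add: \<eta>_def)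
  have G: "1 / \<eta> \<le> real_of_int G"
    using \<epsilon> L by (simp add: \<eta>_def G_def)
  have "0 < 1 / \<eta>" using \<eta> by simp
  then have "0 < real_of_int G" using G by linarith
  then have "0 \<le> \<eta> * real_of_int G" using \<eta> by simp
  define g where "g v t = (\<Sum>j\<in>J. wt t j * (\<eta> * real_of_int (v j)))" for v :: "'j \<Rightarrow> int" and t
  define V where "V = (\<Pi>\<^sub>E j\<in>J. {- G..G})"
  have "finite V" unfolding V_def using J by (intro finite_PiE) auto
  have "card V = nat (2 * G + 1) ^ card J"
    unfolding V_def using J by (simp add: card_PiE algebra_simps)
  then have card: "card (g ` V) \<le> nat (2 * G + 1) ^ card J"
    using card_image_le[OF \<open>finite V\<close>, of g] by simp
  have g_bounded: "g v \<in> bounded_funs T" if "v \<in> V" for v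
  proof -
    have "\<bar>g v t\<bar> \<le> \<eta> * real_of_int G * L" if t: "t \<in> T" for t
    proof -
      have "\<bar>g v t\<bar> \<le> (\<Sum>j\<in>J. \<bar>wt t j\<bar> * (\<eta> * real_of_int G))"
        unfolding g_def
      proof (rule sum_abs[THEN order_trans], rule sum_mono)
        fix j assume "j \<in> J"
        then have "- G \<le> v j" "v j \<le> G" using \<open>v \<in> V\<close> by (auto simp: V_def PiE_iff)
        then have "\<bar>real_of_int (v j)\<bar> \<le> real_of_int G" by linarith
        then have "\<eta> * \<bar>real_of_int (v j)\<bar> \<le> \<eta> * real_of_int G"
          using \<eta> by (intro mult_left_mono) auto
        then show "\<bar>wt t j * (\<eta> * real_of_int (v j))\<bar> \<le> \<bar>wt t j\<bar> * (\<eta> * real_of_int G)"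
          using \<eta> by (simp add: abs_mult mult_left_mono)
      qed
      also have "\<dots> = (\<Sum>j\<in>J. \<bar>wt t j\<bar>) * (\<eta> * real_of_int G)"
        by (simp add: sum_distrib_right)
      also have "\<dots> \<le> L * (\<eta> * real_of_int G)"
        using weights[OF t] \<open>0 \<le> \<eta> * real_of_int G\<close> by (intro mult_right_mono)
      finally show ?thesis by (simp add: mult_ac)
    qed
    then show ?thesis
      unfolding bounded_funs_def bounded_iff by auto
  qed
  have cover: "\<exists>v\<in>V. h \<in> sup_ball T (g v) \<epsilon>" if h: "h \<in> A" for h
  proof -
    define v where "v = restrict (\<lambda>j. \<lfloor>h (x j) / \<eta>\<rfloor>) J"
    have round: "\<bar>h (x j) - \<eta> * real_of_int (v j)\<bar> \<le> \<eta>" if "j \<in> J" for j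
    proof -
      have "real_of_int (v j) \<le> h (x j) / \<eta>" "h (x j) / \<eta> < real_of_int (v j) + 1"
        using that by (simp_all add: v_def)
      then show ?thesis using \<eta> by (simp add: field_simps abs_le_iff)
    qed
    have "v \<in> V"
    proof -
      have "- G \<le> \<lfloor>h (x j) / \<eta>\<rfloor> \<and> \<lfloor>h (x j) / \<eta>\<rfloor> \<le> G" if "j \<in> J" for j
      proof -
        have "\<bar>h (x j)\<bar> \<le> 1" using bounded[OF h] J that by blast
        then have "\<bar>h (x j) / \<eta>\<bar> \<le> 1 / \<eta>" using \<eta> by (simp add: abs_divide divide_right_mono)
        then have "- real_of_int G \<le> h (x j) / \<eta>" "h (x j) / \<eta> \<le> real_of_int G"
          using G by linarith+
        then show ?thesis by (simp add: le_floor_iff floor_le_iff)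
      qed
      then show ?thesis by (auto simp: V_def v_def)
    qed
    have err: "\<bar>h t - g v t\<bar> \<le> \<epsilon> / 2" if t: "t \<in> T" for t
    proof -
      have "\<bar>(\<Sum>j\<in>J. wt t j * h (x j)) - g v t\<bar> \<le> (\<Sum>j\<in>J. \<bar>wt t j\<bar> * \<eta>)"
        unfolding g_def sum_subtractf[symmetric]
      proof (rule sum_abs[THEN order_trans], rule sum_mono)
        fix j assume "j \<in> J"
        then show "\<bar>wt t j * h (x j) - wt t j * (\<eta> * real_of_int (v j))\<bar> \<le> \<bar>wt t j\<bar> * \<eta>"
          using round by (simp add: abs_mult mult_left_mono flip: right_diff_distrib)
      qed
      also have "\<dots> \<le> L * \<eta>"
        using weights[OF t] \<eta> by (simp add: mult_right_mono flip: sum_distrib_right)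
      also have "\<dots> = \<epsilon> / 4" using L by (simp add: \<eta>_def)
      finally show ?thesis using approx[OF h t] by linarith
    qed
    have "sup_norm_on T (\<lambda>t. h t - g v t) \<le> \<epsilon> / 2"
      unfolding sup_norm_on_def using T err by (intro cSUP_least) auto
    moreover have "h \<in> bounded_funs T"
      using bounded[OF h] unfolding bounded_funs_def bounded_iff by auto
    ultimately have "h \<in> sup_ball T (g v) \<epsilon>"
      using \<epsilon> by (simp add: sup_ball_def)
    then show ?thesis using \<open>v \<in> V\<close> by blast
  qed
  have "covering_number T \<epsilon> A \<le> enat (card (g ` V))"
    unfolding covering_number_def
  proof (intro Inf_lower CollectI exI[of _ "g ` V"] conjI)
    show "A \<subseteq> (\<Union>f\<in>g ` V. sup_ball T f \<epsilon>)" using cover by auto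
  qed (use \<open>finite V\<close> g_bounded in auto)
  also have "\<dots> \<le> enat (nat (2 * G + 1) ^ card J)"
    using card by simp
  finally show ?thesis by (simp add: G_def)
qed

section \<open>Covariance kernels of Gaussian processes\<close>

lemma (in prob_space) integrable_square_centered_gaussian:
  assumes "centered_gaussian M X"
  shows "integrable M X" "integrable M (\<lambda>\<omega>. (X \<omega>)\<^sup>2)"
proof -
  have meas [measurable]: "X \<in> borel_measurable M"
    using assms by (simp add: centered_gaussian_def)
  have "integrable M (\<lambda>\<omega>. X \<omega> ^ k)" if "k > 0" for k
    using assms unfolding centered_gaussian_def
  proof (elim conjE disjE exE)
    assume "AE \<omega> in M. X \<omega> = 0"
    then have "AE \<omega> in M. X \<omega> ^ k = 0" using that by auto
    then show ?thesis
      by (subst integrable_cong_AE[where g = "\<lambda>_. 0"]) auto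
  next
    fix \<sigma> :: real assume "0 < \<sigma>" "distributed M lborel X (normal_density 0 \<sigma>)"
    then show ?thesis
      using integrable_normal_moment[of \<sigma> 0 k] distributed_integrable[of M lborel X "normal_density 0 \<sigma>" "\<lambda>x. x ^ k"]
      by simp
  qed
  from this[of 1] this[of 2] show "integrable M X" "integrable M (\<lambda>\<omega>. (X \<omega>)\<^sup>2)"
    by simp_all
qed

text \<open>The quadratic form of a covariance kernel is the second moment of a linear combination of the
  centered variables. Gaussianity enters through the existence of second moments; without them the
  integrals that define the kernel would be default values.\<close>

lemma psd_kernel_cov_kernel:
  fixes W :: "'i \<Rightarrow> 'w \<Rightarrow> real"
  assumes W: "centered_gaussian_process M T W"
  shows "psd_kernel T (cov_kernel M W)"
proof
  show "cov_kernel M W s t = cov_kernel M W t s" for s t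
    by (simp add: cov_kernel_def mult.commute)
next
  fix F and c :: "'i \<Rightarrow> real" assume F: "finite F" "F \<subseteq> T"
  interpret prob_space M using W by (simp add: centered_gaussian_process_def)
  define V where "V s \<omega> = W s \<omega> - (\<integral>\<omega>'. W s \<omega>' \<partial>M)" for s \<omega>
  have gauss: "centered_gaussian M (W s)" if "s \<in> F" for s
    using W F that unfolding centered_gaussian_process_def
    by (auto dest!: conjunct2 spec[of _ "{s}"] spec[of _ "\<lambda>_. 1"])
  have V_meas: "V s \<in> borel_measurable M" if "s \<in> F" for s
    using gauss[OF that] unfolding V_def centered_gaussian_def
    by (intro borel_measurable_diff) auto
  have V_sq: "integrable M (\<lambda>\<omega>. (V s \<omega>)\<^sup>2)" if "s \<in> F" for s
    using integrable_square_centered_gaussian[OF gauss[OF that]]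
    by (simp add: V_def power2_diff)
  have V_prod: "integrable M (\<lambda>\<omega>. V s \<omega> * V t \<omega>)" if "s \<in> F" "t \<in> F" for s t
  proof (rule Bochner_Integration.integrable_bound)
    show "integrable M (\<lambda>\<omega>. (V s \<omega>)\<^sup>2 + (V t \<omega>)\<^sup>2)"
      using V_sq that by simp
    show "(\<lambda>\<omega>. V s \<omega> * V t \<omega>) \<in> borel_measurable M"
      using V_meas that by simp
    have "\<bar>x * y\<bar> \<le> x\<^sup>2 + y\<^sup>2" for x y :: real
    proof -
      have "2 * (\<bar>x\<bar> * \<bar>y\<bar>) \<le> x\<^sup>2 + y\<^sup>2" using sum_squares_bound[of "\<bar>x\<bar>" "\<bar>y\<bar>"] by simp
      moreover have "0 \<le> \<bar>x\<bar> * \<bar>y\<bar>" by simp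
      ultimately show ?thesis unfolding abs_mult by linarith
    qed
    then show "AE \<omega> in M. norm (V s \<omega> * V t \<omega>) \<le> norm ((V s \<omega>)\<^sup>2 + (V t \<omega>)\<^sup>2)"
      by simp
  qed
  have "0 \<le> (\<integral>\<omega>. (\<Sum>s\<in>F. c s * V s \<omega>)\<^sup>2 \<partial>M)" by simp
  also have "\<dots> = (\<integral>\<omega>. (\<Sum>s\<in>F. \<Sum>t\<in>F. c s * c t * (V s \<omega> * V t \<omega>)) \<partial>M)"
    by (simp add: power2_eq_square sum_product mult_ac)
  also have "\<dots> = (\<Sum>s\<in>F. \<Sum>t\<in>F. c s * c t * cov_kernel M W s t)"
    using V_prod by (simp add: cov_kernel_def flip: V_def)
  finally show "0 \<le> (\<Sum>s\<in>F. \<Sum>t\<in>F. c s * c t * cov_kernel M W s t)" .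
qed


section \<open>Interpolation in the unit ball\<close>

text \<open>The weights \<open>w\<close> at the points \<open>y\<close> form the error functional of interpolation at \<open>x\<close>, and the
  left-hand side is this functional applied to \<open>f (\<beta> * (s - t))\<close> in both variables. For fixed \<open>s\<close>,
  the Taylor polynomial of \<open>f\<close> at 0 is a polynomial in \<open>t\<close> of degree less than \<open>n\<close>, which the
  functional annihilates, so that only the Taylor remainder \<open>\<delta>\<close> counts. Each of the two applications
  costs the total weight, which is at most \<open>1 + 6 ^ n \<le> 7 ^ n\<close>.\<close>

lemma lagrange_error_form_le:
  fixes f :: "real \<Rightarrow> real" and x :: real
  assumes x: "0 \<le> x" "x \<le> real n" and n: "0 < n"
    and f: "\<And>u. \<bar>u\<bar> \<le> \<beta> * real n \<Longrightarrow> \<bar>f u - (\<Sum>k<n. b k * u ^ k)\<bar> \<le> \<delta>" and \<beta>: "0 \<le> \<beta>"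
  defines "y \<equiv> \<lambda>i. if i = n then x else real i"
    and "w \<equiv> \<lambda>i. if i = n then 1 else - lagrange_weight n i x"
  shows "(\<Sum>i\<le>n. \<Sum>j\<le>n. w i * w j * f (\<beta> * (y i - y j))) \<le> 49 ^ n * \<delta>"
proof -
  have split: "(\<Sum>i\<le>n. g i) = g n + (\<Sum>i<n. g i)" for g :: "nat \<Rightarrow> real"
    by (simp add: atMost_Suc lessThan_Suc_atMost[symmetric] add.commute)
  have y: "0 \<le> y i" "y i \<le> real n" if "i \<le> n" for i
    using that x by (auto simp: y_def)
  have annihilate: "(\<Sum>j\<le>n. w j * poly p (y j)) = 0" if "degree p < n" for p :: "real poly"
    unfolding split using lagrange_weight_reproduces[OF that, of x]
    by (simp add: w_def y_def sum_negf)
  have total: "(\<Sum>i\<le>n. \<bar>w i\<bar>) \<le> 7 ^ n"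
  proof -
    have "(\<Sum>i\<le>n. \<bar>w i\<bar>) \<le> 1 + 6 ^ n"
      unfolding split using sum_lagrange_weight_le[OF x] by (simp add: w_def)
    also have "1 + 6 ^ n \<le> (7::real) ^ n"
    proof -
      obtain k where k: "n = Suc k" using n by (cases n) auto
      have "1 + 6 * 6 ^ k \<le> 7 * (7::real) ^ k"
        using power_mono[of "6::real" 7 k] one_le_power[of "7::real" k] by linarith
      then show ?thesis by (simp add: k)
    qed
    finally show ?thesis .
  qed
  have "0 \<le> \<delta>" using f[of 0] \<beta> by (auto intro: order_trans[OF abs_ge_zero])
  have inner: "\<bar>\<Sum>j\<le>n. w j * f (\<beta> * (y i - y j))\<bar> \<le> 7 ^ n * \<delta>" if "i \<le> n" for i
  proof -
    define p where "p = (\<Sum>k<n. smult (b k) ([:\<beta> * y i, - \<beta>:] ^ k))"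
    have p: "poly p z = (\<Sum>k<n. b k * (\<beta> * (y i - z)) ^ k)" for z
      by (simp add: p_def poly_sum algebra_simps)
    have "degree ([:\<beta> * y i, - \<beta>:] ^ k) < n" if "k < n" for k
      using degree_power_le[of "[:\<beta> * y i, - \<beta>:]" k] that
      by (auto intro: le_less_trans split: if_splits)
    then have "degree p < n"
      unfolding p_def using n by (intro degree_sum_less) (auto intro: le_less_trans[OF degree_smult_le])
    then have "(\<Sum>j\<le>n. w j * f (\<beta> * (y i - y j)))
        = (\<Sum>j\<le>n. w j * (f (\<beta> * (y i - y j)) - poly p (y j)))"
      using annihilate by (simp add: right_diff_distrib sum_subtractf)
    also have "\<bar>\<dots>\<bar> \<le> (\<Sum>j\<le>n. \<bar>w j\<bar> * \<delta>)"
    proof (rule sum_abs[THEN order_trans], rule sum_mono)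
      fix j assume "j \<in> {..n}"
      then have "\<bar>\<beta> * (y i - y j)\<bar> \<le> \<beta> * real n"
        using y[of i] y[of j] \<open>i \<le> n\<close> \<beta> by (simp add: abs_mult mult_left_mono abs_le_iff)
      then show "\<bar>w j * (f (\<beta> * (y i - y j)) - poly p (y j))\<bar> \<le> \<bar>w j\<bar> * \<delta>"
        using f by (simp add: abs_mult p mult_left_mono)
    qed
    also have "\<dots> \<le> 7 ^ n * \<delta>"
      using total \<open>0 \<le> \<delta>\<close> by (simp add: mult_right_mono flip: sum_distrib_right)
    finally show ?thesis .
  qed
  have "(\<Sum>i\<le>n. \<Sum>j\<le>n. w i * w j * f (\<beta> * (y i - y j)))
      = (\<Sum>i\<le>n. w i * (\<Sum>j\<le>n. w j * f (\<beta> * (y i - y j))))"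
    by (simp add: sum_distrib_left mult.assoc)
  also have "\<dots> \<le> (\<Sum>i\<le>n. \<bar>w i\<bar> * (7 ^ n * \<delta>))"
  proof (rule sum_mono)
    fix i assume i: "i \<in> {..n}"
    have "w i * (\<Sum>j\<le>n. w j * f (\<beta> * (y i - y j)))
        \<le> \<bar>w i\<bar> * \<bar>\<Sum>j\<le>n. w j * f (\<beta> * (y i - y j))\<bar>"
      by (simp flip: abs_mult)
    also have "\<dots> \<le> \<bar>w i\<bar> * (7 ^ n * \<delta>)"
      using inner i by (intro mult_left_mono) auto
    finally show "w i * (\<Sum>j\<le>n. w j * f (\<beta> * (y i - y j))) \<le> \<bar>w i\<bar> * (7 ^ n * \<delta>)" .
  qed
  also have "\<dots> \<le> 7 ^ n * (7 ^ n * \<delta>)"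
    using total \<open>0 \<le> \<delta>\<close> by (simp add: mult_right_mono flip: sum_distrib_right)
  also have "\<dots> = 49 ^ n * \<delta>"
    by (simp flip: power_mult_distrib mult.assoc)
  finally show ?thesis .
qed

text \<open>On an interval of length \<open>1 / m\<close> all time differences are at most \<open>1 / 196\<close> of the radius of
  the disc on which the kernel is controlled. As \<open>196 = 4 * 49\<close>, the decay \<open>196 ^ (- n)\<close> of the Taylor
  remainder beats the factor \<open>49 ^ n\<close> from interpolation and leaves \<open>4 ^ (- n)\<close> for the squared dual norm
  of the error functional.\<close>

lemma rkhs_unit_ball_interpolation:
  fixes K :: "real \<Rightarrow> real \<Rightarrow> real"
  assumes K: "psd_kernel {0..1} K"
    and K_eq: "\<And>t t'. t \<in> {0..1} \<Longrightarrow> t' \<in> {0..1} \<Longrightarrow> K t t' = sqexp_periodic_kernel a t t'"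
    and a: "0 < a" and m: "196 * pi * max a 1 \<le> real m"
    and n: "0 < n" and p: "p < m" and x: "0 \<le> x" "x \<le> real n"
    and h: "h \<in> rkhs_unit_ball {0..1} K"
  shows "\<bar>h ((real p + x / real n) / real m)
      - (\<Sum>i<n. lagrange_weight n i x * h ((real p + real i / real n) / real m))\<bar> \<le> exp 19 / 2 ^ n"
proof -
  define f where "f u = exp (- 4 * a\<^sup>2 * (sin (pi * u))\<^sup>2)" for u
  define \<rho> where "\<rho> = 1 / (pi * max a 1)"
  have "0 < \<rho>" by (simp add: \<rho>_def)
  obtain b where b: "\<And>k. \<bar>b k\<bar> \<le> exp 36 / \<rho> ^ k"
    and sums: "\<And>u. \<bar>u\<bar> < \<rho> \<Longrightarrow> (\<lambda>k. b k * u ^ k) sums f u"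
    using sqexp_periodic_taylor[OF a] unfolding \<rho>_def f_def by blast
  define \<beta> where "\<beta> = 1 / (real n * real m)"
  have m_pos: "0 < real m" using p by simp
  have \<beta>: "0 \<le> \<beta>" "\<beta> * real n = 1 / real m" using n by (simp_all add: \<beta>_def)
  have "0 < pi * max a 1" by simp
  then have small: "1 / real m \<le> 1 / 196 * \<rho>"
    using m m_pos unfolding \<rho>_def by (simp add: divide_le_eq le_divide_eq mult_ac)
  have tail: "\<bar>f u - (\<Sum>k<n. b k * u ^ k)\<bar> \<le> 2 * exp 36 * (1 / 196) ^ n" if "\<bar>u\<bar> \<le> \<beta> * real n" for u
  proof (rule power_series_tail_bound[OF b])
    show "\<bar>u\<bar> \<le> 1 / 196 * \<rho>" using that \<beta>(2) small by linarith
    then have "\<bar>u\<bar> < \<rho>" using \<open>0 < \<rho>\<close> by linarith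
    then show "(\<lambda>k. b k * u ^ k) sums f u" by (rule sums)
  qed (use \<open>0 < \<rho>\<close> in auto)
  define y where "y = (\<lambda>i. if i = n then x else real i)"
  define w where "w = (\<lambda>i. if i = n then 1 else - lagrange_weight n i x)"
  define z where "z i = (real p + y i / real n) / real m" for i
  have z: "z i \<in> {0..1}" if "i \<le> n" for i
  proof -
    have "0 \<le> y i / real n" "y i / real n \<le> 1"
      using that x n by (auto simp: y_def)
    moreover have "real p + 1 \<le> real m" using p by simp
    ultimately have "0 \<le> real p + y i / real n" "real p + y i / real n \<le> real m" by auto
    then show ?thesis using m_pos by (simp add: z_def)
  qed
  have "z i - z j = \<beta> * (y i - y j)" for i j
    using n m_pos by (simp add: z_def \<beta>_def field_simps)
  then have K_z: "K (z i) (z j) = f (\<beta> * (y i - y j))" if "i \<le> n" "j \<le> n" for i j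
    using K_eq[OF z z, OF that] by (simp add: sqexp_periodic_kernel_def f_def flip: right_diff_distrib)
  have "(\<Sum>i\<le>n. \<Sum>j\<le>n. w i * w j * K (z i) (z j)) = (\<Sum>i\<le>n. \<Sum>j\<le>n. w i * w j * f (\<beta> * (y i - y j)))"
    using K_z by simp
  also have "\<dots> \<le> 49 ^ n * (2 * exp 36 * (1 / 196) ^ n)"
    unfolding y_def w_def by (rule lagrange_error_form_le[OF x n tail \<beta>(1)])
  also have "\<dots> = 2 * exp 36 * (49 * (1 / 196)) ^ n"
    by (simp only: power_mult_distrib mult_ac)
  \<comment> \<open>Rounding 2 up to \<open>exp 2\<close> makes the bound a perfect square.\<close>
  also have "\<dots> \<le> exp 2 * exp 36 * (1 / 4) ^ n"
    using exp_ge_add_one_self[of 2] by simp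
  also have "\<dots> = (exp 19 / 2 ^ n)\<^sup>2"
    by (simp add: power_divide power2_eq_square flip: exp_add power_mult_distrib)
  finally have "sqrt (\<Sum>i\<le>n. \<Sum>j\<le>n. w i * w j * K (z i) (z j)) \<le> exp 19 / 2 ^ n"
    by (intro real_le_lsqrt) auto
  moreover have "\<bar>\<Sum>i\<le>n. w i * h (z i)\<bar> \<le> sqrt (\<Sum>i\<le>n. \<Sum>j\<le>n. w i * w j * K (z i) (z j))"
    using z by (intro psd_kernel.sampling_bound[OF K h]) auto
  moreover have "(\<Sum>i\<le>n. w i * h (z i)) = h ((real p + x / real n) / real m)
      - (\<Sum>i<n. lagrange_weight n i x * h ((real p + real i / real n) / real m))"
    by (simp add: lessThan_Suc_atMost[symmetric] w_def z_def y_def sum_negf)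
  ultimately show ?thesis by simp
qed

section \<open>The entropy bound\<close>

text \<open>The unit interval is cut into \<open>m\<close> pieces with \<open>n\<close> nodes each, and a function of the unit ball is
  recovered on every piece by interpolation at the nodes of that piece.\<close>

lemma covering_number_rkhs_unit_ball_le:
  fixes K :: "real \<Rightarrow> real \<Rightarrow> real"
  assumes K: "psd_kernel {0..1} K"
    and K_eq: "\<And>t t'. t \<in> {0..1} \<Longrightarrow> t' \<in> {0..1} \<Longrightarrow> K t t' = sqexp_periodic_kernel a t t'"
    and a: "0 < a" and m: "196 * pi * max a 1 \<le> real m" and n: "0 < n"
    and \<epsilon>: "0 < \<epsilon>" "exp 19 / 2 ^ n \<le> \<epsilon> / 4"
  shows "covering_number {0..1} \<epsilon> (rkhs_unit_ball {0..1} K)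
    \<le> enat (nat (2 * \<lceil>4 * 6 ^ n / \<epsilon>\<rceil> + 1) ^ (m * n))"
proof -
  define J where "J = {..<m} \<times> {..<n}"
  define node where "node = (\<lambda>(p, i). (real p + real i / real n) / real m)"
  \<comment> \<open>The minimum puts the right end point 1 into the last piece.\<close>
  define piece where "piece t = min (m - 1) (nat \<lfloor>real m * t\<rfloor>)" for t
  \<comment> \<open>The local coordinate of \<open>t\<close> on its piece, scaled so that the nodes become the integers below \<open>n\<close>.\<close>
  define loc where "loc t = real n * (real m * t - real (piece t))" for t
  define wt where "wt t = (\<lambda>(p, i). if p = piece t then lagrange_weight n i (loc t) else 0)" for t
  have m_pos: "0 < real m"
  proof -
    have "0 < 196 * pi * max a 1" by simp
    then show ?thesis using m by linarith
  qed
  have piece: "piece t < m" "0 \<le> loc t" "loc t \<le> real n"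
    "t = (real (piece t) + loc t / real n) / real m" if t: "t \<in> {0..1}" for t
  proof -
    show "piece t < m" using m_pos by (simp add: piece_def)
    have fl: "real (nat \<lfloor>real m * t\<rfloor>) \<le> real m * t" "real m * t < real (nat \<lfloor>real m * t\<rfloor>) + 1"
      using t by (auto simp: of_nat_nat)
    have "real m * t \<le> real m" using t m_pos by (simp add: mult_left_le)
    then have "real (piece t) \<le> real m * t" "real m * t \<le> real (piece t) + 1"
      using fl m_pos by (auto simp: piece_def min_def of_nat_diff)
    then show "0 \<le> loc t" "loc t \<le> real n" 
      using n by (simp_all add: loc_def mult_left_le)
    show "t = (real (piece t) + loc t / real n) / real m"
      using n m_pos by (simp add: loc_def)
  qed
  have wt_sum: "(\<Sum>j\<in>J. g (wt t j) j) = (\<Sum>i<n. g (lagrange_weight n i (loc t)) (piece t, i))"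
    if t: "t \<in> {0..1}" and g: "\<And>j. g 0 j = 0" for t and g :: "real \<Rightarrow> nat \<times> nat \<Rightarrow> real"
  proof -
    have "(\<Sum>j\<in>J. g (wt t j) j) = (\<Sum>p<m. \<Sum>i<n. g (wt t (p, i)) (p, i))"
      unfolding J_def by (simp add: sum.cartesian_product)
    also have "\<dots> = (\<Sum>p<m. if p = piece t then \<Sum>i<n. g (lagrange_weight n i (loc t)) (p, i) else 0)"
      by (intro sum.cong) (auto simp: wt_def g)
    also have "\<dots> = (\<Sum>i<n. g (lagrange_weight n i (loc t)) (piece t, i))"
      using piece(1)[OF t] by simp
    finally show ?thesis .
  qed
  have "covering_number {0..1} \<epsilon> (rkhs_unit_ball {0..1} K)
      \<le> enat (nat (2 * \<lceil>4 * 6 ^ n / \<epsilon>\<rceil> + 1) ^ card J)"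
  proof (rule covering_number_le_of_sampling[where x = node and wt = wt])
    show "node ` J \<subseteq> {0..1}"
    proof -
      have "node (p, i) \<in> {0..1}" if "p < m" "i < n" for p i
      proof -
        have "real i / real n \<le> 1" "0 \<le> real i / real n" using that by auto
        moreover have "real p + 1 \<le> real m" using that by simp
        ultimately have "0 \<le> real p + real i / real n" "real p + real i / real n \<le> real m" by auto
        then show ?thesis using m_pos by (simp add: node_def)
      qed
      then show ?thesis by (auto simp: J_def)
    qed
    show "\<bar>h t\<bar> \<le> 1" if "h \<in> rkhs_unit_ball {0..1} K" "t \<in> {0..1}" for h t
    proof -
      \<comment> \<open>A single evaluation has dual norm \<open>sqrt (K t t) = 1\<close>.\<close>
      have "\<bar>\<Sum>i\<in>{()}. 1 * h t\<bar> \<le> sqrt (\<Sum>i\<in>{()}. \<Sum>j\<in>{()}. 1 * 1 * K t t)"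
        using that by (intro psd_kernel.sampling_bound[OF K]) auto
      then show ?thesis using K_eq that by (simp add: sqexp_periodic_kernel_def)
    qed
    show "(\<Sum>j\<in>J. \<bar>wt t j\<bar>) \<le> 6 ^ n" if t: "t \<in> {0..1}" for t
      using wt_sum[OF t, of "\<lambda>c j. \<bar>c\<bar>"] sum_lagrange_weight_le[OF piece(2,3)[OF t]] by simp
    show "\<bar>h t - (\<Sum>j\<in>J. wt t j * h (node j))\<bar> \<le> \<epsilon> / 4"
      if h: "h \<in> rkhs_unit_ball {0..1} K" and t: "t \<in> {0..1}" for h t
    proof -
      have "(\<Sum>j\<in>J. wt t j * h (node j)) = (\<Sum>i<n. lagrange_weight n i (loc t)
          * h ((real (piece t) + real i / real n) / real m))"
        using wt_sum[OF t, of "\<lambda>c j. c * h (node j)"] by (simp add: node_def)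
      then have "\<bar>h t - (\<Sum>j\<in>J. wt t j * h (node j))\<bar> \<le> exp 19 / 2 ^ n"
        using rkhs_unit_ball_interpolation[OF K K_eq a m n piece(1-3)[OF t] h]
        by (simp flip: piece(4)[OF t])
      then show ?thesis using \<epsilon>(2) by (rule order_trans)
    qed
  qed (use \<epsilon> in \<open>auto simp: J_def\<close>)
  then show ?thesis by (simp add: J_def)
qed

text \<open>With \<open>l = ln (1 / \<epsilon>)\<close>, a number \<open>m\<close> of pieces of order \<open>max a 1\<close> and a number \<open>n\<close> of nodes of
  order \<open>l\<close> suffice. A single rounded value takes at most \<open>11 * 6 ^ n / \<epsilon>\<close> values, whose logarithm is
  again of order \<open>l\<close>. All additive constants are absorbed by \<open>l \<ge> 1 / 2\<close>. The three numerical
  factors bound \<open>m\<close>, \<open>n\<close> and this logarithm in units of \<open>max a 1\<close>, \<open>l\<close> and \<open>l\<close>.\<close>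

lemma log_covering_number_rkhs_unit_ball_le:
  fixes K :: "real \<Rightarrow> real \<Rightarrow> real"
  assumes K: "psd_kernel {0..1} K"
    and K_eq: "\<And>t t'. t \<in> {0..1} \<Longrightarrow> t' \<in> {0..1} \<Longrightarrow> K t t' = sqexp_periodic_kernel a t t'"
    and a: "0 < a" and \<epsilon>: "0 < \<epsilon>" "\<epsilon> < 1 / 2"
  defines "N \<equiv> covering_number {0..1} \<epsilon> (rkhs_unit_ball {0..1} K)"
  shows "N \<noteq> \<infinity> \<and> ln (real (the_enat N)) \<le> 785 * 92 * 481 * max a 1 * (ln (1 / \<epsilon>))\<^sup>2"
proof -
  define l where "l = ln (1 / \<epsilon>)"
  have exp_l: "exp l = 1 / \<epsilon>" using \<epsilon> by (simp add: l_def)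
  have "ln 2 \<le> l" using \<epsilon> unfolding l_def by (subst ln_le_cancel_iff) (auto simp: field_simps)
  then have l: "1 / 2 \<le> l" using ln2_ge_two_thirds by linarith
  define m where "m = nat \<lceil>196 * pi * max a 1\<rceil>"
  \<comment> \<open>The choice \<open>n * ln 2 \<ge> 22 + l\<close> makes \<open>2 ^ n\<close> exceed \<open>exp 19 * 4 / \<epsilon>\<close>, as \<open>exp 3 \<ge> 4\<close>.\<close>
  define n where "n = nat \<lceil>2 * (22 + l)\<rceil>"
  have m_ge: "196 * pi * max a 1 \<le> real m"
    unfolding m_def by (rule real_nat_ceiling_ge)
  have m_le: "real m \<le> 785 * max a 1"
  proof -
    have "0 \<le> 196 * pi * max a 1" by simp
    then have "real m \<le> 196 * pi * max a 1 + 1" unfolding m_def by linarith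
    moreover have "pi * max a 1 \<le> 4 * max a 1" using pi_less_4 by (intro mult_right_mono) auto
    ultimately show ?thesis by linarith
  qed
  have n_ge: "2 * (22 + l) \<le> real n" unfolding n_def by (rule real_nat_ceiling_ge)
  have n_le: "real n \<le> 92 * l" 
  proof -
    have "real n \<le> 2 * (22 + l) + 1" unfolding n_def using of_int_ceiling_le_add_one[of "2 * (22 + l)"] l by simp
    also have "\<dots> = 45 + 2 * l" by simp
    also have "\<dots> \<le> 92 * l" using l by simp
    finally show ?thesis .
  qed
  have n_pos: "0 < n" using n_ge l by (cases n) auto
  have fine: "exp 19 / 2 ^ n \<le> \<epsilon> / 4"
  proof -
    have "real n * (1 / 2) \<le> real n * ln 2"
      using ln2_ge_two_thirds by (intro mult_left_mono) auto
    then have "22 + l \<le> real n * ln 2" using n_ge by simp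
    then have "exp (22 + l) \<le> exp (real n * ln 2)" by simp
    also have "\<dots> = 2 ^ n" by (simp add: exp_of_nat_mult)
    finally have "exp 19 * exp 3 * exp l \<le> 2 ^ n" by (simp flip: exp_add)
    moreover have "exp 19 * 4 * exp l \<le> exp 19 * exp 3 * exp l"
      using exp_ge_add_one_self[of 3] by simp
    ultimately have "exp 19 * 4 * exp l \<le> 2 ^ n" by linarith
    then show ?thesis using \<epsilon> exp_l by (simp add: field_simps)
  qed
  define G where "G = \<lceil>4 * 6 ^ n / \<epsilon>\<rceil>"
  define c where "c = nat (2 * G + 1)"
  have N: "N \<le> enat (c ^ (m * n))"
    unfolding N_def c_def G_def by (rule covering_number_rkhs_unit_ball_le[OF K K_eq a m_ge n_pos \<epsilon>(1) fine])
  then obtain k where k: "N = enat k" "k \<le> c ^ (m * n)"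
    by (cases N) auto
  have one_le: "1 \<le> 6 ^ n / \<epsilon>"
  proof -
    have "\<epsilon> \<le> 1" using \<epsilon> by simp
    also have "1 \<le> (6::real) ^ n" by simp
    finally show ?thesis using \<epsilon> by (simp add: le_divide_eq)
  qed
  have "0 < G" using \<epsilon> by (simp add: G_def)
  then have c_pos: "1 \<le> c" by (simp add: c_def)
  have "real c \<le> 11 * (6 ^ n / \<epsilon>)"
  proof -
    have "real c = 2 * real_of_int G + 1"
      using \<open>0 < G\<close> by (simp add: c_def)
    moreover have "real_of_int G \<le> 4 * (6 ^ n / \<epsilon>) + 1"
      unfolding G_def using of_int_ceiling_le_add_one[of "4 * 6 ^ n / \<epsilon>"] by simp
    ultimately show ?thesis using one_le by linarith
  qed
  then have "ln (real c) \<le> ln (11 * (6 ^ n / \<epsilon>))"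
    using c_pos by (intro ln_mono) auto
  also have "\<dots> = ln 11 + real n * ln 6 + l"
    using \<epsilon> by (simp add: ln_mult ln_div ln_realpow l_def)
  also have "\<dots> \<le> 10 + real n * 5 + l"
    using ln_le_minus_one[of "11::real"] ln_le_minus_one[of "6::real"]
    by (intro add_mono mult_left_mono) auto
  also have "\<dots> \<le> 10 + 92 * l * 5 + l" using n_le by simp
  also have "\<dots> \<le> 481 * l" using l by simp
  finally have ln_c: "ln (real c) \<le> 481 * l" .
  \<comment> \<open>The value \<open>k = 0\<close> needs its own case, where \<open>ln 0 = 0\<close>.\<close>
  have "ln (real k) \<le> ln (real (c ^ (m * n)))"
  proof (cases "k = 0")
    case True
    have "1 \<le> real (c ^ (m * n))" using c_pos by (simp add: one_le_power)
    then show ?thesis using True by simp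
  next
    case False
    then show ?thesis using k(2) by (intro ln_mono) (simp_all del: of_nat_power)
  qed
  also have "\<dots> = real m * real n * ln (real c)"
    using c_pos by (simp add: ln_realpow)
  also have "\<dots> \<le> (785 * max a 1) * (92 * l) * (481 * l)"
    using m_le n_le ln_c l c_pos by (intro mult_mono) auto
  also have "\<dots> = 785 * 92 * 481 * max a 1 * l\<^sup>2"
    by (simp add: power2_eq_square)
  finally show ?thesis by (simp add: k(1) l_def)
qed

theorem lemma4p5:
  shows "\<exists>C::real. C > 0 \<and>
    (\<forall>(M :: 'w measure) (W :: real \<Rightarrow> 'w \<Rightarrow> real) (a::real) (\<epsilon>::real).
       a > 0 \<and> centered_gaussian_process M {0..1} W \<and>
       (\<forall>t\<in>{0..1}. \<forall>t'\<in>{0..1}. cov_kernel M W t t' = sqexp_periodic_kernel a t t') \<and>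
       0 < \<epsilon> \<and> \<epsilon> < 1/2 \<longrightarrow>
       covering_number {0..1} \<epsilon> (process_rkhs_unit_ball M {0..1} W) \<noteq> \<infinity> \<and>
       ln (real (the_enat (covering_number {0..1} \<epsilon> (process_rkhs_unit_ball M {0..1} W))))
         \<le> C * max a 1 * (ln (1 / \<epsilon>))\<^sup>2)"
proof (intro exI[of _ "785 * 92 * 481"] conjI[of "_ > _"] allI impI)
  fix M :: "'w measure" and W :: "real \<Rightarrow> 'w \<Rightarrow> real" and a \<epsilon> :: real
  assume *: "a > 0 \<and> centered_gaussian_process M {0..1} W \<and>
    (\<forall>t\<in>{0..1}. \<forall>t'\<in>{0..1}. cov_kernel M W t t' = sqexp_periodic_kernel a t t') \<and>
    0 < \<epsilon> \<and> \<epsilon> < 1/2"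
  then have "psd_kernel {0..1} (cov_kernel M W)"
    by (intro psd_kernel_cov_kernel) simp
  from log_covering_number_rkhs_unit_ball_le[OF this, of a \<epsilon>] *
  show "covering_number {0..1} \<epsilon> (process_rkhs_unit_ball M {0..1} W) \<noteq> \<infinity> \<and>
      ln (real (the_enat (covering_number {0..1} \<epsilon> (process_rkhs_unit_ball M {0..1} W))))
        \<le> 785 * 92 * 481 * max a 1 * (ln (1 / \<epsilon>))\<^sup>2"
    by (simp add: process_rkhs_unit_ball_def)
qed simp

end
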